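(* For $\theta=(a,b,c)\in\Theta_{\mathbb{H}}$ let $\theta_{\mathbb{L}}=(a+c,\,a-c,\,2b)\in\Theta_{\mathbb{L}}$. Then: (i) For all $\theta,\theta'\in\Theta_{\mathbb{H}}$, $$[\theta_{\mathbb{L}},\theta_{\mathbb{L}}]=4|\theta|,\qquad[\theta'_{\mathbb{L}},\theta'_{\mathbb{L}}]=4|\theta'|,\qquad[\theta_{\mathbb{L}},\theta'_{\mathbb{L}}]=2|\theta|\,\mathrm{tr}(\theta'\theta^{-1}),$$ where on the right-hand sides $\theta=(a,b,c)$ is identified with the matrix $\begin{bmatrix} a & b \\ b & c \end{bmatrix}$ and $|\cdot|$ is the determinant. (ii) For every convex $f:(0,\infty)\to\mathbb{R}$ with $f(1)=0$ and all $\theta,\theta'\in\Theta_{\mathbb{H}}$, $$D_f^{\mathbb{L}}\left[p_{\theta_{\mathbb{L}}}:p_{\theta'_{\mathbb{L}}}\right]=D_f^{\mathbb{H}}\left[p_\theta:p_{\theta'}\right],$$ where the left-hand side is the $f$-divergence between 2D hyperboloid distributions and the right-hand side is the $f$-divergence between Poincaré distributions.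
   Context: $\Theta_{\mathbb{H}}=\{(a,b,c)\in\mathbb{R}^3:a>0,\ c>0,\ ac>b^2\}$. For $\theta=(a,b,c)\in\Theta_{\mathbb{H}}$, the Poincaré distribution $p_\theta$ is the probability distribution on $\mathbb{H}=\{(x,y)\in\mathbb{R}^2:y>0\}$ with density (with respect to $dx\,dy$) $$p_\theta(x,y)=\frac{\sqrt{ac-b^2}\,e^{2\sqrt{ac-b^2}}}{\pi}\exp\left(-\frac{a(x^2+y^2)+2bx+c}{y}\right)\frac1{y^2}.$$ $[x,y]=x_0y_0-x_1y_1-x_2y_2$ is the Minkowski inner product on $\mathbb{R}^3$, and $\Theta_{\mathbb{L}}=\{\vartheta\in\mathbb{R}^3:\vartheta_0>\sqrt{\vartheta_1^2+\vartheta_2^2}\}$. For $\vartheta\in\Theta_{\mathbb{L}}$ the 2D hyperboloid distribution $p_\vartheta$ is the probability distribution on $\mathbb{R}^2$ with Lebesgue density $$p_\vartheta(x_1,x_2)=\frac{r e^{r}}{2\pi}\,\frac{\exp\left(-(\vartheta_0\sqrt{1+x_1^2+x_2^2}-\vartheta_1x_1-\vartheta_2x_2)\right)}{\sqrt{1+x_1^2+x_2^2}},\qquad r=[\vartheta,\vartheta]^{1/2}.$$ The $f$-divergence between densities $p,q$ on a domain $\mathcal{X}$ ($\mathcal X=\mathbb{H}$ for $D_f^{\mathbb{H}}$, $\mathcal X=\mathbb{R}^2$ for $D_f^{\mathbb{L}}$) is $\int_{\mathcal X}p\,f(q/p)\,dx\,dy\in[0,+\infty]$. *)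

theory Defs
  imports "HOL-Analysis.Analysis"
begin

definition Theta_H :: "(real \<times> real \<times> real) set" where
  "Theta_H = {(a, b, c). a > 0 \<and> c > 0 \<and> a * c > b\<^sup>2}"

definition upper_half_plane :: "(real \<times> real) set" where
  "upper_half_plane = {(x, y). y > 0}"

text \<open>Only the values on the upper half-plane are meaningful.\<close>

definition poincare_density :: "real \<times> real \<times> real \<Rightarrow> real \<times> real \<Rightarrow> real" where
  "poincare_density = (\<lambda>(a, b, c) (x, y).
     sqrt (a * c - b\<^sup>2) * exp (2 * sqrt (a * c - b\<^sup>2)) / pi
       * exp (- ((a * (x\<^sup>2 + y\<^sup>2) + 2 * b * x + c) / y)) * (1 / y\<^sup>2))"

definition minkowski :: "real \<times> real \<times> real \<Rightarrow> real \<times> real \<times> real \<Rightarrow> real" where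
  "minkowski = (\<lambda>(x0, x1, x2) (y0, y1, y2). x0 * y0 - x1 * y1 - x2 * y2)"

definition Theta_L :: "(real \<times> real \<times> real) set" where
  "Theta_L = {(t0, t1, t2). t0 > sqrt (t1\<^sup>2 + t2\<^sup>2)}"

definition hyperboloid_density :: "real \<times> real \<times> real \<Rightarrow> real \<times> real \<Rightarrow> real" where
  "hyperboloid_density = (\<lambda>(t0, t1, t2) (x1, x2).
     let r = sqrt (minkowski (t0, t1, t2) (t0, t1, t2)) in
     r * exp r / (2 * pi)
       * (exp (- (t0 * sqrt (1 + x1\<^sup>2 + x2\<^sup>2) - t1 * x1 - t2 * x2))
            / sqrt (1 + x1\<^sup>2 + x2\<^sup>2)))"

text \<open>
  The Lebesgue integral of \<open>p f(q/p)\<close> over \<open>X\<close> as an extended real, i.e. the integral of the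
  positive part minus that of the negative part (\<^const>\<open>ennreal\<close> truncates negative numbers to 0).
  The Bochner integral is unsuitable, as it yields 0 for a divergent integral.
  For convex \<open>f\<close> and integrable densities the negative part has a finite integral, since
  \<open>f\<close> has an affine minorant, so that no difference of infinities arises.
\<close>

definition f_divergence ::
  "(real \<times> real) set \<Rightarrow> (real \<Rightarrow> real) \<Rightarrow> (real \<times> real \<Rightarrow> real) \<Rightarrow> (real \<times> real \<Rightarrow> real) \<Rightarrow> ereal"
where
  "f_divergence X f p q =
     enn2ereal (\<integral>\<^sup>+z\<in>X. ennreal (p z * f (q z / p z)) \<partial>lborel)
     - enn2ereal (\<integral>\<^sup>+z\<in>X. ennreal (- (p z * f (q z / p z))) \<partial>lborel)"

definition to_L :: "real \<times> real \<times> real \<Rightarrow> real \<times> real \<times> real" where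
  "to_L = (\<lambda>(a, b, c). (a + c, a - c, 2 * b))"

definition to_matrix :: "real \<times> real \<times> real \<Rightarrow> real^2^2" where
  "to_matrix = (\<lambda>(a, b, c). vector [vector [a, b], vector [b, c]])"

end

theory Submission
  imports Defs "HOL-Real_Asymp.Real_Asymp"
begin

text \<open>
  The map \<open>(x, y) \<mapsto> ((1 - x\<^sup>2 - y\<^sup>2) / (2 y), - x / y)\<close> is the chart of the hyperboloid under the
  isometry with the half-plane; its time coordinate is \<open>X\<^sub>0 = (1 + x\<^sup>2 + y\<^sup>2) / (2 y)\<close>. Since
  \<open>X\<^sub>0 - X\<^sub>1 = (x\<^sup>2 + y\<^sup>2) / y\<close> and \<open>X\<^sub>0 + X\<^sub>1 = 1 / y\<close>, the exponents of the two families agree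
  under \<^const>\<open>to_L\<close>, and the invariant measures \<open>dX\<^sub>1 dX\<^sub>2 / X\<^sub>0\<close> and \<open>dx dy / y\<^sup>2\<close> correspond.
  Hence the densities differ by the Jacobian alone, which cancels in the quotient \<open>q / p\<close>.
\<close>

section \<open>Substitution from the half-line to the line\<close>

text \<open>On compact intervals this is the usual substitution rule. Compact intervals
  \<open>A n\<close> exhaust the half-line and, by the two limits of \<open>g\<close>, the intervals
  \<open>B n\<close> between the endpoint values exhaust the line.\<close>

lemma nn_integral_substitution_Ioi:
  fixes f :: "real \<Rightarrow> ennreal" and g g' :: "real \<Rightarrow> real"
  assumes [measurable]: "f \<in> borel_measurable borel" "g \<in> borel_measurable borel"
      "g' \<in> borel_measurable borel"
    and deriv: "\<And>y. 0 < y \<Longrightarrow> (g has_real_derivative g' y) (at y)"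
    and cont: "continuous_on {0<..} g'"
    and nonneg: "\<And>y. 0 < y \<Longrightarrow> 0 \<le> g' y"
    and top: "filterlim g at_top at_top"
    and bot: "filterlim g at_bot (at_right 0)"
  shows "(\<integral>\<^sup>+x. f x \<partial>lborel) = (\<integral>\<^sup>+y\<in>{0<..}. f (g y) * ennreal (g' y) \<partial>lborel)"
proof -
  \<comment> \<open>The shift by 2 keeps \<open>a n < b n\<close> strict at \<open>n = 0\<close>,
    where the endpoints are 1 and 2.\<close>
  define a b where "a n = inverse (real (Suc n))" and "b n = real n + 2" for n
  define A B where "A n = {a n..b n}" and "B n = {g (a n)..g (b n)}" for n
  have a0: "0 < a n" for n by (simp add: a_def)
  have ab: "a n < b n" for n by (simp add: a_def b_def field_simps add_pos_nonneg)
  have a_mono: "a n \<le> a m" and b_mono: "b m \<le> b n" if "m \<le> n" for m n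
    using that by (auto simp: a_def b_def field_simps)
  have mono: "g x \<le> g y" if "0 < x" "x \<le> y" for x y
    using that(2)
  proof (rule DERIV_nonneg_imp_nondecreasing)
    fix z assume "x \<le> z"
    with that(1) have "0 < z" by simp
    then show "\<exists>d. (g has_real_derivative d) (at z) \<and> 0 \<le> d"
      using deriv nonneg by blast
  qed
  have b_lim: "filterlim b at_top sequentially"
    unfolding b_def by real_asymp
  have a_lim: "filterlim a (at_right 0) sequentially"
    unfolding a_def by real_asymp
  have "incseq A" using a_mono b_mono by (force simp: A_def incseq_def intro: order_trans)
  have "incseq B"
  proof (rule incseq_SucI)
    fix n
    have "g (a (Suc n)) \<le> g (a n)" "g (b n) \<le> g (b (Suc n))"
      using a0 a_mono b_mono less_trans[OF a0 ab] by (auto intro!: mono)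
    then show "B n \<subseteq> B (Suc n)" by (auto simp: B_def)
  qed
  have UB: "(\<Union>n. B n) = UNIV"
  proof -
    have "\<exists>n. x \<in> B n" for x
    proof -
      have "eventually (\<lambda>n. x \<le> g (b n)) sequentially"
        using filterlim_compose[OF top b_lim] by (simp add: filterlim_at_top)
      moreover have "eventually (\<lambda>n. g (a n) \<le> x) sequentially"
        using filterlim_compose[OF bot a_lim] by (simp add: filterlim_at_bot)
      ultimately have "eventually (\<lambda>n. x \<in> B n) sequentially"
        by eventually_elim (simp add: B_def)
      then show ?thesis by (auto simp: eventually_sequentially)
    qed
    then show ?thesis by blast
  qed
  have UA: "(\<Union>n. A n) = {0<..}"
  proof -
    have "\<exists>n. x \<in> A n" if "0 < x" for x
    proof -
      have "eventually (\<lambda>n. x \<le> b n) sequentially"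
        using b_lim by (simp add: filterlim_at_top)
      moreover have "eventually (\<lambda>n. a n < x) sequentially"
        using a_lim that by (auto simp: filterlim_at dest: order_tendstoD(2))
      ultimately have "eventually (\<lambda>n. x \<in> A n) sequentially"
        by eventually_elim (simp add: A_def)
      then show ?thesis by (auto simp: eventually_sequentially)
    qed
    then show ?thesis using less_le_trans[OF a0] by (auto simp: A_def)
  qed
  have [measurable]: "A n \<in> sets borel" "B n \<in> sets borel" for n by (simp_all add: A_def B_def)
  \<comment> \<open>Read as measures with densities, the integrals over \<open>B n\<close> and
    \<open>A n\<close> converge to those over the unions by continuity from below.\<close>
  let ?M = "density lborel f" and ?N = "density lborel (\<lambda>y. f (g y) * ennreal (g' y))"
  have "emeasure ?M (B n) = emeasure ?N (A n)" for n
    using nn_integral_substitution_aux[of f "a n" "b n" g g'] ab[of n] a0[of n] deriv nonneg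
    by (simp add: emeasure_density A_def B_def continuous_on_subset[OF cont] subset_iff
        less_le_trans[OF a0])
  moreover have "(\<lambda>n. emeasure ?M (B n)) \<longlonglongrightarrow> emeasure ?M (\<Union>n. B n)"
    using \<open>incseq B\<close> by (intro Lim_emeasure_incseq) auto
  moreover have "(\<lambda>n. emeasure ?N (A n)) \<longlonglongrightarrow> emeasure ?N (\<Union>n. A n)"
    using \<open>incseq A\<close> by (intro Lim_emeasure_incseq) auto
  ultimately have "emeasure ?M UNIV = emeasure ?N {0<..}"
    unfolding UA UB by (simp add: LIMSEQ_unique)
  then show ?thesis by (simp add: emeasure_density)
qed

text \<open>On the slice of the hyperboloid with X2 = u, put k = 1 + u^2. Then (X0 + X1) (X0 - X1) =
  k, so X0 + X1 = 1 / y forces X0 - X1 = k y and X1 = (1 / y - k y) / 2.\<close>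

lemma nn_integral_hyperboloid_slice:
  fixes F :: "real \<Rightarrow> ennreal" and k :: real
  assumes [measurable]: "F \<in> borel_measurable borel" and k: "0 < k"
  shows "(\<integral>\<^sup>+v. F v \<partial>lborel)
    = (\<integral>\<^sup>+y\<in>{0<..}. F ((1 / y - k * y) / 2) * ennreal ((1 / y\<^sup>2 + k) / 2) \<partial>lborel)"
proof -
  \<comment> \<open>X1 decreases in y; the reflection makes the substitution increasing.\<close>
  have "(\<integral>\<^sup>+v. F v \<partial>lborel) = (\<integral>\<^sup>+v. F (- v) \<partial>lborel)"
    using nn_integral_real_affine[of F "-1" 0] by simp
  also have "\<dots> = (\<integral>\<^sup>+y\<in>{0<..}. F (- ((k * y - 1 / y) / 2)) * ennreal ((1 / y\<^sup>2 + k) / 2) \<partial>lborel)"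
  proof (rule nn_integral_substitution_Ioi[of "\<lambda>v. F (- v)"])
    show "((\<lambda>y. (k * y - 1 / y) / 2) has_real_derivative (1 / y\<^sup>2 + k) / 2) (at y)" if "0 < y" for y
      using that by (auto intro!: derivative_eq_intros simp: power2_eq_square field_simps)
    show "filterlim (\<lambda>y. (k * y - 1 / y) / 2) at_top at_top" using k by real_asymp
    show "filterlim (\<lambda>y. (k * y - 1 / y) / 2) at_bot (at_right 0)" using k by real_asymp
  qed (use k in \<open>auto intro!: continuous_intros\<close>)
  finally show ?thesis by (simp add: minus_divide_left)
qed

section \<open>The chart and its change of variables\<close>

definition chart :: "real \<times> real \<Rightarrow> real \<times> real" where
  "chart = (\<lambda>(x, y). ((1 - x\<^sup>2 - y\<^sup>2) / (2 * y), - x / y))"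

text \<open>This is X0 / y^2, the absolute value of the Jacobian determinant of
  \<open>chart\<close>; the determinant itself is negative on the half-plane.\<close>

definition chart_jacobian :: "real \<times> real \<Rightarrow> real" where
  "chart_jacobian = (\<lambda>(x, y). (1 + x\<^sup>2 + y\<^sup>2) / (2 * y) / y\<^sup>2)"

lemma measurable_chart [measurable]: "chart \<in> borel_measurable borel"
  unfolding chart_def case_prod_beta borel_prod[symmetric] by measurable

lemma measurable_chart_jacobian [measurable]: "chart_jacobian \<in> borel_measurable borel"
  unfolding chart_jacobian_def case_prod_beta borel_prod[symmetric] by measurable

lemma measurable_upper_half_plane [measurable]: "upper_half_plane \<in> sets borel"
proof -
  have "upper_half_plane = {z \<in> space borel. 0 < snd z}" by (auto simp: upper_half_plane_def)
  also have "\<dots> \<in> sets borel" unfolding borel_prod[symmetric] by measurable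
  finally show ?thesis .
qed

text \<open>
  Both sides are slices along \<open>u = X\<^sub>2 = - x / y\<close>: for fixed \<open>y\<close> the substitution \<open>x = - y u\<close> is
  linear, and for fixed \<open>u\<close> the map \<open>y \<mapsto> X\<^sub>1\<close> is a bijection from \<open>(0, \<infinity>)\<close> to the line.
\<close>

lemma nn_integral_chart:
  fixes F :: "real \<times> real \<Rightarrow> ennreal"
  assumes [measurable]: "F \<in> borel_measurable borel"
  shows "(\<integral>\<^sup>+z. F z \<partial>lborel)
    = (\<integral>\<^sup>+z\<in>upper_half_plane. F (chart z) * ennreal (chart_jacobian z) \<partial>lborel)"
proof -
  have [measurable]: "F \<in> borel_measurable (borel \<Otimes>\<^sub>M borel)" by (simp add: borel_prod)
  define H where "H u y = F ((1 / y - (1 + u\<^sup>2) * y) / 2, u) * ennreal ((1 / y\<^sup>2 + (1 + u\<^sup>2)) / 2)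
    * indicator {0<..} y" for u y :: real
  define G where "G z = F (chart z) * ennreal (chart_jacobian z) * indicator upper_half_plane z" for z
  have [measurable]: "G \<in> borel_measurable borel" unfolding G_def by measurable
  then have [measurable]: "G \<in> borel_measurable (borel \<Otimes>\<^sub>M borel)" by (simp add: borel_prod)
  have "(\<integral>\<^sup>+z. F z \<partial>lborel) = (\<integral>\<^sup>+u. \<integral>\<^sup>+v. F (v, u) \<partial>lborel \<partial>lborel)"
    using lborel_pair.nn_integral_snd[of F] by (simp add: lborel_prod)
  also have "\<dots> = (\<integral>\<^sup>+u. \<integral>\<^sup>+y. H u y \<partial>lborel \<partial>lborel)"
    unfolding H_def
    by (intro nn_integral_cong nn_integral_hyperboloid_slice) (auto simp: add_pos_nonneg)
  \<comment> \<open>Exchanging the order leaves u as the inner variable, ready for x = - y u at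
    fixed y.\<close>
  also have "\<dots> = (\<integral>\<^sup>+y. \<integral>\<^sup>+u. H u y \<partial>lborel \<partial>lborel)"
    unfolding H_def by (intro lborel_pair.Fubini'[symmetric]) measurable
  also have "\<dots> = (\<integral>\<^sup>+y. \<integral>\<^sup>+x. G (x, y) \<partial>lborel \<partial>lborel)"
  proof (rule nn_integral_cong)
    fix y :: real
    show "(\<integral>\<^sup>+u. H u y \<partial>lborel) = (\<integral>\<^sup>+x. G (x, y) \<partial>lborel)"
    proof (cases "0 < y")
      case True
      \<comment> \<open>The slice derivative is X0 / y = y * (X0 / y^2); its factor y is |dx/du| and
        is absorbed by the linear substitution.\<close>
      have "H u y = ennreal y * G (- y * u, y)" for u
      proof -
        have "chart (- y * u, y) = ((1 / y - (1 + u\<^sup>2) * y) / 2, u)"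
          using True by (simp add: chart_def field_simps power2_eq_square)
        moreover have "(1 / y\<^sup>2 + (1 + u\<^sup>2)) / 2 = y * chart_jacobian (- y * u, y)"
          using True by (simp add: chart_jacobian_def field_simps power2_eq_square)
        ultimately show ?thesis
          using True by (simp add: H_def G_def upper_half_plane_def ennreal_mult' mult_ac)
      qed
      then have "(\<integral>\<^sup>+u. H u y \<partial>lborel) = ennreal y * (\<integral>\<^sup>+u. G (- y * u, y) \<partial>lborel)"
        by (simp add: nn_integral_cmult)
      also have "\<dots> = (\<integral>\<^sup>+x. G (x, y) \<partial>lborel)"
        using nn_integral_real_affine[of "\<lambda>x. G (x, y)" "- y" 0] True by simp
      finally show ?thesis .
    qed (simp add: H_def G_def upper_half_plane_def)
  qed
  also have "\<dots> = (\<integral>\<^sup>+z. G z \<partial>lborel)"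
    using lborel_pair.nn_integral_snd[of G] by (simp add: lborel_prod)
  finally show ?thesis by (simp add: G_def)
qed

section \<open>The densities in the chart\<close>

lemma continuous_hyperboloid_density: "continuous_on UNIV (hyperboloid_density \<theta>)"
proof -
  have "1 + x\<^sup>2 + y\<^sup>2 \<noteq> 0" for x y :: real
    by (smt (verit) zero_le_power2)
  then show ?thesis
    by (cases \<theta>) (auto simp: hyperboloid_density_def case_prod_beta Let_def intro!: continuous_intros)
qed

lemma minkowski_to_L: "minkowski (to_L (a, b, c)) (to_L (a, b, c)) = 4 * (a * c - b\<^sup>2)"
  by (simp add: minkowski_def to_L_def algebra_simps power2_eq_square)

lemma hyperboloid_density_pos:
  assumes "\<theta> \<in> Theta_H"
  shows "0 < hyperboloid_density (to_L \<theta>) z"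
proof (cases \<theta>)
  case (fields a b c)
  then have "0 < sqrt (minkowski (to_L (a, b, c)) (to_L (a, b, c)))"
    using assms unfolding minkowski_to_L by (simp add: Theta_H_def)
  moreover have "0 < 1 + (fst z)\<^sup>2 + (snd z)\<^sup>2" by (smt (verit) zero_le_power2)
  ultimately show ?thesis
    by (simp add: fields hyperboloid_density_def to_L_def Let_def case_prod_beta)
qed

text \<open>The normalising constants agree because r is twice the root of the determinant, and the
  X0 in the denominator cancels against the Jacobian X0 / y^2, leaving 1 / y^2.\<close>

lemma hyperboloid_density_chart:
  assumes "z \<in> upper_half_plane"
  shows "hyperboloid_density (to_L \<theta>) (chart z) * chart_jacobian z = poincare_density \<theta> z"
proof (cases \<theta>)
  case (fields a b c)
  obtain x y where z: "z = (x, y)" and y: "0 < y"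
    using assms by (auto simp: upper_half_plane_def)
  define X0 where "X0 = (1 + x\<^sup>2 + y\<^sup>2) / (2 * y)"
  define X1 where "X1 = (1 - x\<^sup>2 - y\<^sup>2) / (2 * y)"
  have X0: "0 < X0" using y by (simp add: X0_def add_pos_nonneg)
  \<comment> \<open>The image point lies on the hyperboloid; as X0 is positive, it is the square
    root in the density.\<close>
  have sq: "1 + X1\<^sup>2 + (- x / y)\<^sup>2 = X0\<^sup>2"
    using y by (simp add: X0_def X1_def field_simps power2_eq_square)
  have root: "sqrt (1 + X1\<^sup>2 + (- x / y)\<^sup>2) = X0"
    unfolding sq using X0 by simp
  have expo: "(a + c) * X0 - (a - c) * X1 - 2 * b * (- x / y) = (a * (x\<^sup>2 + y\<^sup>2) + 2 * b * x + c) / y"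
    using y by (simp add: X0_def X1_def field_simps)
  have r: "sqrt (minkowski (a + c, a - c, 2 * b) (a + c, a - c, 2 * b)) = 2 * sqrt (a * c - b\<^sup>2)"
    unfolding minkowski_to_L[of a b c, unfolded to_L_def prod.case] real_sqrt_mult by simp
  have "hyperboloid_density (to_L \<theta>) (X1, - x / y)
      = 2 * sqrt (a * c - b\<^sup>2) * exp (2 * sqrt (a * c - b\<^sup>2)) / (2 * pi)
        * (exp (- ((a * (x\<^sup>2 + y\<^sup>2) + 2 * b * x + c) / y)) / X0)"
    unfolding fields to_L_def hyperboloid_density_def prod.case Let_def r root expo ..
  moreover have "chart z = (X1, - x / y)" "chart_jacobian z = X0 / y\<^sup>2"
    by (simp_all add: z chart_def chart_jacobian_def X0_def X1_def)
  ultimately show ?thesis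
    using X0 by (simp add: fields z poincare_density_def)
qed

section \<open>Equality of the f-divergences\<close>

lemma f_divergence_hyperboloid_eq_poincare:
  fixes f :: "real \<Rightarrow> real"
  assumes f: "convex_on {0<..} f" and \<theta>: "\<theta> \<in> Theta_H" and \<theta>': "\<theta>' \<in> Theta_H"
  shows "f_divergence UNIV f (hyperboloid_density (to_L \<theta>)) (hyperboloid_density (to_L \<theta>'))
    = f_divergence upper_half_plane f (poincare_density \<theta>) (poincare_density \<theta>')"
proof -
  let ?P = "hyperboloid_density (to_L \<theta>)" and ?Q = "hyperboloid_density (to_L \<theta>')"
  let ?p = "poincare_density \<theta>" and ?q = "poincare_density \<theta>'"
  define \<phi> where "\<phi> z = ?P z * f (?Q z / ?P z)" for z
  note pos = hyperboloid_density_pos[OF \<theta>] hyperboloid_density_pos[OF \<theta>']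
  have nz: "?P z \<noteq> 0" for z using pos(1)[of z] by simp
  \<comment> \<open>Convexity on an open interval gives continuity. Both densities are positive, so
    their quotient stays in that interval and \<open>\<phi>\<close> is Borel on the whole
    plane.\<close>
  have "continuous_on {0<..} f" using f by (intro convex_on_continuous) auto
  then have "continuous_on UNIV (\<lambda>z. f (?Q z / ?P z))"
    by (rule continuous_on_compose2)
      (auto intro!: continuous_on_divide continuous_hyperboloid_density simp: nz pos)
  then have [measurable]: "\<phi> \<in> borel_measurable borel"
    unfolding \<phi>_def
    by (intro borel_measurable_continuous_onI continuous_on_mult continuous_hyperboloid_density)
  \<comment> \<open>The Jacobian cancels inside \<open>f\<close> and survives once, as the outer
    factor.\<close>
  have phi: "\<phi> (chart z) * chart_jacobian z = ?p z * f (?q z / ?p z)"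
    if z: "z \<in> upper_half_plane" for z
  proof -
    have "0 < chart_jacobian z"
      using z by (auto simp: chart_jacobian_def upper_half_plane_def add_pos_nonneg)
    then show ?thesis
      by (simp add: \<phi>_def hyperboloid_density_chart[OF z, symmetric] mult_ac)
  qed
  have jac: "0 \<le> chart_jacobian z" if "z \<in> upper_half_plane" for z
    using that by (auto simp: chart_jacobian_def upper_half_plane_def)
  \<comment> \<open>The sign \<open>s\<close> treats the positive part (1) and the negative part
    (-1) at once.\<close>
  have "(\<integral>\<^sup>+z. ennreal (s * \<phi> z) \<partial>lborel)
      = (\<integral>\<^sup>+z\<in>upper_half_plane. ennreal (s * (?p z * f (?q z / ?p z))) \<partial>lborel)" for s :: real
  proof -
    have "(\<integral>\<^sup>+z. ennreal (s * \<phi> z) \<partial>lborel)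
        = (\<integral>\<^sup>+z\<in>upper_half_plane. ennreal (s * \<phi> (chart z)) * ennreal (chart_jacobian z) \<partial>lborel)"
      by (rule nn_integral_chart) measurable
    also have "\<dots> = (\<integral>\<^sup>+z\<in>upper_half_plane. ennreal (s * (?p z * f (?q z / ?p z))) \<partial>lborel)"
    proof (rule nn_integral_cong)
      fix z
      have "ennreal (s * \<phi> (chart z)) * ennreal (chart_jacobian z)
          = ennreal (s * (?p z * f (?q z / ?p z)))"
        if z: "z \<in> upper_half_plane"
        unfolding phi[OF z, symmetric] mult.assoc[symmetric]
        \<comment> \<open>Truncation at 0 commutes with a nonnegative factor, whatever the sign of
          \<open>s * \<phi> (chart z)\<close>.\<close>
        by (rule ennreal_mult''[OF jac[OF z], symmetric])
      then show "ennreal (s * \<phi> (chart z)) * ennreal (chart_jacobian z) * indicator upper_half_plane z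
          = ennreal (s * (?p z * f (?q z / ?p z))) * indicator upper_half_plane z"
        by (simp split: split_indicator)
    qed
    finally show ?thesis .
  qed
  from this[of 1] this[of "-1"] show ?thesis
    by (simp add: f_divergence_def \<phi>_def)
qed

section \<open>Parameters and matrix identities\<close>

text \<open>The difference (a + c)^2 - (a - c)^2 - (2 b)^2 equals 4 (a c - b^2), which is positive,
  and a + c is positive.\<close>

lemma to_L_in_Theta_L:
  assumes "\<theta> \<in> Theta_H"
  shows "to_L \<theta> \<in> Theta_L"
proof -
  obtain a b c where \<theta>: "\<theta> = (a, b, c)" and "0 < a" "0 < c" "b\<^sup>2 < a * c"
    using assms by (auto simp: Theta_H_def)
  then have "sqrt ((a - c)\<^sup>2 + (2 * b)\<^sup>2) < a + c"
    by (intro real_less_lsqrt) (auto simp: power2_eq_square algebra_simps)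
  then show ?thesis by (simp add: \<theta> to_L_def Theta_L_def)
qed

lemma det_to_matrix: "det (to_matrix (a, b, c)) = a * c - b\<^sup>2"
  by (simp add: to_matrix_def det_2 power2_eq_square)

lemma matrix_inv_to_matrix:
  assumes "a * c - b\<^sup>2 \<noteq> 0"
  shows "matrix_inv (to_matrix (a, b, c))
    = to_matrix (c / (a * c - b\<^sup>2), - b / (a * c - b\<^sup>2), a / (a * c - b\<^sup>2))" (is "_ = ?B")
proof -
  let ?A = "to_matrix (a, b, c)"
  have AB: "?A ** ?B = mat 1" and BA: "?B ** ?A = mat 1"
    using assms by (simp_all add: to_matrix_def matrix_matrix_mult_def vec_eq_iff forall_2 sum_2
        mat_def diff_divide_distrib[symmetric] add_divide_distrib[symmetric] power2_eq_square
        algebra_simps)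
  then have "\<exists>B. ?A ** B = mat 1 \<and> B ** ?A = mat 1" by blast
  \<comment> \<open>\<open>matrix_inv\<close> is a choice of a two-sided inverse; the explicit
    \<open>?B\<close> shows that one exists, and uniqueness of inverses then identifies the chosen
    one.\<close>
  then have inv: "?A ** matrix_inv ?A = mat 1 \<and> matrix_inv ?A ** ?A = mat 1"
    unfolding matrix_inv_def by (rule someI_ex)
  have "matrix_inv ?A = matrix_inv ?A ** (?A ** ?B)" by (simp only: AB matrix_mul_rid)
  also have "\<dots> = ?B" by (simp only: matrix_mul_assoc inv matrix_mul_lid)
  finally show ?thesis .
qed

text \<open>The determinant times the inverse is the adjugate, with entries c, -b, a. Its trace
  against \<theta>' is a' c - 2 b b' + c' a, half of the expanded Minkowski product.\<close>

lemma minkowski_to_L_trace: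
  assumes "\<theta> \<in> Theta_H"
  shows "minkowski (to_L \<theta>) (to_L \<theta>')
    = 2 * det (to_matrix \<theta>) * trace (to_matrix \<theta>' ** matrix_inv (to_matrix \<theta>))"
proof -
  obtain a b c where \<theta>: "\<theta> = (a, b, c)" and D: "a * c - b\<^sup>2 \<noteq> 0"
    using assms by (auto simp: Theta_H_def)
  obtain a' b' c' where \<theta>': "\<theta>' = (a', b', c')" by (cases \<theta>')
  define d where "d = a * c - b\<^sup>2"
  have "d * trace (to_matrix \<theta>' ** matrix_inv (to_matrix \<theta>)) = a' * c - 2 * b * b' + c' * a"
    using D unfolding \<theta> matrix_inv_to_matrix[OF D] d_def[symmetric]
    by (simp add: \<theta>' to_matrix_def trace_def matrix_matrix_mult_def sum_2 field_simps)
  then show ?thesis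
    unfolding \<theta> \<theta>' det_to_matrix d_def[symmetric]
    by (simp add: minkowski_def to_L_def algebra_simps)
qed

theorem proposition9:
  shows "(\<forall>\<theta>\<in>Theta_H. to_L \<theta> \<in> Theta_L)
    \<and> (\<forall>\<theta>\<in>Theta_H. \<forall>\<theta>'\<in>Theta_H.
           minkowski (to_L \<theta>) (to_L \<theta>) = 4 * det (to_matrix \<theta>) \<and>
           minkowski (to_L \<theta>') (to_L \<theta>') = 4 * det (to_matrix \<theta>') \<and>
           minkowski (to_L \<theta>) (to_L \<theta>')
             = 2 * det (to_matrix \<theta>) * trace (to_matrix \<theta>' ** matrix_inv (to_matrix \<theta>)))
    \<and> (\<forall>f :: real \<Rightarrow> real. convex_on {0<..} f \<and> f 1 = 0 \<longrightarrow>
           (\<forall>\<theta>\<in>Theta_H. \<forall>\<theta>'\<in>Theta_H.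
              f_divergence UNIV f (hyperboloid_density (to_L \<theta>)) (hyperboloid_density (to_L \<theta>'))
              = f_divergence upper_half_plane f (poincare_density \<theta>) (poincare_density \<theta>')))"
proof -
  have "minkowski (to_L \<theta>) (to_L \<theta>) = 4 * det (to_matrix \<theta>)" for \<theta>
    by (cases \<theta>) (simp add: minkowski_to_L det_to_matrix)
  then show ?thesis
    using to_L_in_Theta_L minkowski_to_L_trace f_divergence_hyperboloid_eq_poincare by blast
qed

end
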